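(* For every integer $q$ with $2\le q<\infty$, $$\mathcal{R}_+(\mathcal{T}_{q+1})\subsetneq\mathcal{R}_+(\mathcal{T}_q).$$
   Context: $\mathbb{N}=\{0,1,2,\dots\}$. For an integer $q\ge 2$, $\mathcal{T}_q$ is the $(q+1)$-homogeneous tree (every vertex has degree $q+1$). A graph is identified with its vertex set, and $d$ is the edge-path distance. A function $\psi:X\times X\to\mathbb{C}$ is positive definite if $\sum_{i,j=1}^n\psi(x_i,x_j)\overline{z_i}z_j\ge 0$ for all finite families $x_1,\dots,x_n\in X$ and $z_1,\dots,z_n\in\mathbb{C}$. For a connected graph $X$, $\mathcal{R}_+(X)$ is the set of functions $\varphi:\mathbb{N}\to\mathbb{C}$ such that $(x,y)\mapsto\varphi(d(x,y))$ is positive definite on $X$. *)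

theory Defs
  imports Complex_Main "HOL-Library.Nonpos_Ints" "Graph_Theory.Graph_Theory"
begin

section \<open>Graphs, edge-path distance, homogeneous trees\<close>

text \<open>
  An undirected simple graph, possibly infinite, is a symmetric loop-free digraph without
  parallel arcs, i.e. an instance of \<^locale>\<open>pair_bidirected_digraph\<close>: every edge
  appears as two opposite arcs. The out-degree of a vertex is then its number of neighbours, and
  the length of an arc walk is the number of edges it traverses.
\<close>

definition graph_dist :: "'a pair_pre_digraph \<Rightarrow> 'a \<Rightarrow> 'a \<Rightarrow> nat" where
  "graph_dist G u v = (LEAST n. \<exists>p. pre_digraph.awalk (with_proj G) u p v \<and> length p = n)"

text \<open>
  The predicate \<^const>\<open>tree\<close> of the digraph library forbids directed cycles, and there
  the closed walk along an edge and back is one, so it fails for every symmetric digraph that has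
  an edge. A cycle of the undirected graph is a directed cycle of length at least 3.
\<close>

locale undirected_tree = pair_bidirected_digraph G for G :: "'a pair_pre_digraph" +
  assumes conn: "Digraph_Component.connected (with_proj G)"
    and acyclic: "pre_digraph.cycle (with_proj G) p \<Longrightarrow> length p < 3"

text \<open>
  For \<open>n > 0\<close> the degree condition also forces every vertex to have finitely many
  neighbours.
\<close>

definition homogeneous_tree :: "nat \<Rightarrow> 'a pair_pre_digraph \<Rightarrow> bool" where
  "homogeneous_tree n G \<longleftrightarrow>
     undirected_tree G \<and> (\<forall>v \<in> pverts G. out_degree (with_proj G) v = n)"

text \<open>
  The tree \<open>T\<^sub>q\<close> is determined only up to isomorphism; \<open>is_T q G\<close> says that
  \<open>G\<close> is a copy of it. Every vertex has degree \<open>q + 1\<close>.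
\<close>

definition is_T :: "nat \<Rightarrow> 'a pair_pre_digraph \<Rightarrow> bool" where
  "is_T q G \<longleftrightarrow> homogeneous_tree (q + 1) G"


section \<open>Positive definite functions\<close>

text \<open>
  Membership in \<open>\<real>\<^sub>\<ge>\<^sub>0\<close> says that the complex number is real and
  nonnegative. The points of the family need not be distinct.
\<close>

definition positive_definite_on :: "'a set \<Rightarrow> ('a \<Rightarrow> 'a \<Rightarrow> complex) \<Rightarrow> bool" where
  "positive_definite_on X \<psi> \<longleftrightarrow>
     (\<forall>(n::nat) (x :: nat \<Rightarrow> 'a) (z :: nat \<Rightarrow> complex).
        (\<forall>i<n. x i \<in> X) \<longrightarrow>
        (\<Sum>i<n. \<Sum>j<n. \<psi> (x i) (x j) * cnj (z i) * z j) \<in> \<real>\<^sub>\<ge>\<^sub>0)"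

definition R_plus :: "'a pair_pre_digraph \<Rightarrow> (nat \<Rightarrow> complex) set" where
  "R_plus G = {\<phi>. positive_definite_on (pverts G) (\<lambda>x y. \<phi> (graph_dist G x y))}"


section \<open>Existence of homogeneous trees\<close>

text \<open>
  A copy of \<open>T\<^sub>q\<close> on words, the neighbours of a word being its tail and its
  one-letter extensions at the front.
\<close>

fun word :: "nat \<Rightarrow> nat list \<Rightarrow> bool" where
  "word q [] = True"
| "word q (i # xs) = (i < (if xs = [] then q + 1 else q) \<and> word q xs)"

definition word_tree :: "nat \<Rightarrow> nat list pair_pre_digraph" where
  "word_tree q = \<lparr> pverts = {xs. word q xs},
     parcs = {(xs, ys). word q xs \<and> word q ys \<and> ((\<exists>i. ys = i # xs) \<or> (\<exists>i. xs = i # ys))} \<rparr>"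

lemma pcas_consecutive:
  "pcas u p v \<Longrightarrow> Suc i < length p \<Longrightarrow> fst (p ! Suc i) = snd (p ! i)"
proof (induction p arbitrary: u i)
  case (Cons e es)
  then show ?case by (cases i; cases es) auto
qed simp

lemma pcas_first: "pcas u p v \<Longrightarrow> p \<noteq> [] \<Longrightarrow> fst (p ! 0) = u"
  by (cases p) auto

lemma pcas_last: "pcas u p v \<Longrightarrow> p \<noteq> [] \<Longrightarrow> snd (p ! (length p - 1)) = v"
proof (induction p arbitrary: u)
  case (Cons e es)
  then show ?case by (cases es) auto
qed simp

lemma pawalk_verts_tl: "tl (pawalk_verts u p) = map snd p" if "pcas u p v"
proof -
  have "pawalk_verts u p = u # map snd p" if "pcas u p v" for u
    using that by (induction p arbitrary: u) auto
  with that show ?thesis by simp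
qed

lemma pair_bidirected_word_tree: "pair_bidirected_digraph (word_tree q)"
  by unfold_locales (auto simp: word_tree_def symmetric_def sym_def)

lemma connected_word_tree: "Digraph_Component.connected (with_proj (word_tree q))"
proof -
  let ?G = "with_proj (word_tree q)"
  interpret pair_bidirected_digraph "word_tree q" by (rule pair_bidirected_word_tree)
  have *: "reachable ?G xs [] \<and> reachable ?G [] xs" if "word q xs" for xs
    using that
  proof (induction xs)
    case Nil
    have "[] \<in> verts ?G" by (simp add: word_tree_def)
    then show ?case by (simp add: reachable_refl)
  next
    case (Cons i xs)
    have "(i # xs, xs) \<in> arcs_ends ?G" "(xs, i # xs) \<in> arcs_ends ?G"
      using Cons.prems by (auto simp: word_tree_def)
    then show ?case
      using Cons by (auto intro: adj_reachable_trans reachable_adj_trans)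
  qed
  have verts: "verts ?G = {xs. word q xs}" by (simp add: word_tree_def)
  have "reachable ?G xs ys" if "word q xs" "word q ys" for xs ys
    using *[OF that(1)] *[OF that(2)] by (blast intro: reachable_trans)
  moreover have "[] \<in> {xs. word q xs}" by simp
  ultimately have "strongly_connected ?G"
    unfolding strongly_connected_def verts by blast
  moreover have "mk_symmetric ?G = word_tree q"
    by (auto simp: mk_symmetric_def word_tree_def)
  ultimately show ?thesis by (simp add: Digraph_Component.connected_def)
qed

lemma acyclic_word_tree:
  assumes "pre_digraph.cycle (with_proj (word_tree q)) p"
  shows "length p < 3"
proof (rule ccontr)
  assume "\<not> length p < 3"
  define n where "n = length p"
  have n3: "n \<ge> 3" using \<open>\<not> length p < 3\<close> by (simp add: n_def)
  interpret pair_bidirected_digraph "word_tree q" by (rule pair_bidirected_word_tree)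
  obtain u where cas: "pcas u p u" and sub: "set p \<subseteq> parcs (word_tree q)"
    and dist: "distinct (tl (pawalk_verts u p))"
    using assms by (auto simp: cycle_def awalk_def)
  have ne: "p \<noteq> []" using n3 by (auto simp: n_def)
  have dist: "distinct (map snd p)" using dist pawalk_verts_tl[OF cas] by simp
  have step: "fst (p ! (Suc i mod n)) = snd (p ! i)" if "i < n" for i
  proof (cases "Suc i < n")
    case True
    then show ?thesis using pcas_consecutive[OF cas] by (simp add: n_def)
  next
    case False
    then have "i = n - 1" "Suc i = n" using that by auto
    then show ?thesis using pcas_first[OF cas ne] pcas_last[OF cas ne] by (simp add: n_def)
  qed
  have arc: "(fst (p ! i), snd (p ! i)) \<in> parcs (word_tree q)" if "i < n" for i
    using sub that by (auto simp: n_def)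
  have "Max ((\<lambda>i. length (snd (p ! i))) ` {..<n}) \<in> (\<lambda>i. length (snd (p ! i))) ` {..<n}"
    by (rule Max_in) (use n3 in \<open>auto simp: lessThan_empty_iff\<close>)
  then obtain k where k: "k < n"
    and kmax: "length (snd (p ! k)) = Max ((\<lambda>i. length (snd (p ! i))) ` {..<n})"
    by (metis (no_types, lifting) imageE lessThan_iff)
  have max: "length (snd (p ! i)) \<le> length (snd (p ! k))" if "i < n" for i
    unfolding kmax using that by (intro Max_ge) auto
  define s where "s = Suc k mod n"
  define r where "r = (if k = 0 then n - 1 else k - 1)"
  have s: "s < n" and r: "r < n" using n3 k by (auto simp: s_def r_def)
  have "Suc r mod n = k" using n3 k by (auto simp: r_def)
  then have pr: "fst (p ! k) = snd (p ! r)" using step[OF r] by simp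
  have ps: "fst (p ! s) = snd (p ! k)" using step[OF k] by (simp add: s_def)
  have "snd (p ! r) = tl (snd (p ! k))"
    using arc[OF k] max[OF r] unfolding pr by (auto simp: word_tree_def)
  moreover have "snd (p ! s) = tl (snd (p ! k))"
    using arc[OF s] max[OF s] unfolding ps by (auto simp: word_tree_def)
  ultimately have "r = s"
    using dist r s nth_eq_iff_index_eq[OF dist, of r s] by (simp add: n_def)
  then show False
    using n3 k by (auto simp: r_def s_def mod_Suc split: if_splits)
qed

lemma degree_word_tree:
  assumes "word q xs"
  shows "out_degree (with_proj (word_tree q)) xs = q + 1"
proof (cases xs)
  case Nil
  have "out_arcs (with_proj (word_tree q)) xs = (\<lambda>i. ([], [i])) ` {..<q + 1}"
    using Nil by (auto simp: out_arcs_def word_tree_def)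
  then show ?thesis
    by (simp add: out_degree_def card_image inj_on_def)
next
  case (Cons j ys)
  have "out_arcs (with_proj (word_tree q)) xs = insert (xs, ys) ((\<lambda>i. (xs, i # xs)) ` {..<q})"
    using Cons assms by (auto simp: out_arcs_def word_tree_def)
  moreover have "(xs, ys) \<notin> (\<lambda>i. (xs, i # xs)) ` {..<q}"
    using Cons by auto
  ultimately show ?thesis
    by (simp add: out_degree_def card_image inj_on_def)
qed

lemma is_T_word_tree: "is_T q (word_tree q)"
  unfolding is_T_def homogeneous_tree_def undirected_tree_def undirected_tree_axioms_def
  using pair_bidirected_word_tree connected_word_tree acyclic_word_tree degree_word_tree
  by (auto simp: word_tree_def)

end

theory Submission
  imports Defs
begin

text \<open>
  The inclusion holds because the smaller tree embeds isometrically into the larger one. For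
  strictness, let \<open>\<phi>\<close> be supported on \<open>{0, 2}\<close> with
  \<open>\<phi> 0 = q + 1\<close> and \<open>\<phi> 2 = 1\<close>. On \<open>T\<^sub>q\<close> the number
  \<open>\<phi> (d(x, y))\<close> counts the common neighbours of x and y, so the kernel is the square of
  the adjacency operator A and is positive definite. On the tree of degree \<open>q + 2\<close> it is
  \<open>A\<^sup>2 - 1\<close>, which is not positive because 0 lies in the spectrum of A there.
\<close>

section \<open>Walks and distances\<close>

definition neighbours :: "'a pair_pre_digraph \<Rightarrow> 'a \<Rightarrow> 'a set" where
  "neighbours G v = {w. (v, w) \<in> parcs G}"

lemma out_degree_eq_card_neighbours: "out_degree (with_proj G) v = card (neighbours G v)"
proof -
  have "out_arcs (with_proj G) v = Pair v ` neighbours G v"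
    by (auto simp: out_arcs_def neighbours_def)
  then show ?thesis by (simp add: out_degree_def card_image inj_on_def)
qed

text \<open>Trades arc walks for powers of the arc relation, so that distances can be treated by
  induction on \<open>^^\<close>. The assumption on \<open>u\<close> matters for n = 0, where the
  relation power relates every element to itself but the empty walk must sit at a vertex.\<close>

lemma (in pair_wf_digraph) awalk_length_iff_relpow:
  assumes "u \<in> pverts G"
  shows "(\<exists>p. awalk u p v \<and> length p = n) \<longleftrightarrow> (u, v) \<in> parcs G ^^ n"
  using assms
proof (induction n arbitrary: u)
  case 0
  then show ?case by (auto simp: awalk_Nil_iff)
next
  case (Suc n)
  have "(\<exists>p. awalk u p v \<and> length p = Suc n) \<longleftrightarrow>
    (\<exists>w. (u, w) \<in> parcs G \<and> (\<exists>p. awalk w p v \<and> length p = n))"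
  proof
    assume "\<exists>p. awalk u p v \<and> length p = Suc n"
    then obtain w p where "(u, w) \<in> parcs G" "awalk w p v" "length p = n"
      by (auto simp: length_Suc_conv awalk_Cons_iff)
    then show "\<exists>w. (u, w) \<in> parcs G \<and> (\<exists>p. awalk w p v \<and> length p = n)"
      by blast
  next
    assume "\<exists>w. (u, w) \<in> parcs G \<and> (\<exists>p. awalk w p v \<and> length p = n)"
    then obtain w p where "(u, w) \<in> parcs G" "awalk w p v" "length p = n" by blast
    then show "\<exists>p. awalk u p v \<and> length p = Suc n"
      by (intro exI[of _ "(u, w) # p"]) (simp add: awalk_Cons_iff)
  qed
  also have "\<dots> \<longleftrightarrow> (\<exists>w. (u, w) \<in> parcs G \<and> (w, v) \<in> parcs G ^^ n)"
    using Suc.IH in_arcsD2 by blast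
  also have "\<dots> \<longleftrightarrow> (u, v) \<in> parcs G ^^ Suc n"
    by (metis relpow_Suc_D2 relpow_Suc_I2)
  finally show ?case .
qed

lemma (in pair_wf_digraph) graph_dist_relpow:
  "u \<in> pverts G \<Longrightarrow> graph_dist G u v = (LEAST n. (u, v) \<in> parcs G ^^ n)"
  by (simp add: graph_dist_def awalk_length_iff_relpow)

lemma (in pair_wf_digraph) relpow_in_verts:
  "(u, v) \<in> parcs G ^^ n \<Longrightarrow> u \<in> pverts G \<Longrightarrow> v \<in> pverts G"
  by (induction n arbitrary: v) (auto dest: in_arcsD2)

context undirected_tree
begin

lemma verts_nonempty: "pverts G \<noteq> {}"
  using conn by (auto simp: Digraph_Component.connected_def strongly_connected_def)

lemma relpow_connected:
  assumes "u \<in> pverts G" "v \<in> pverts G"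
  obtains n where "(u, v) \<in> parcs G ^^ n"
proof -
  have "reachable (with_proj (mk_symmetric (with_proj G))) u v"
    using conn assms by (auto simp: Digraph_Component.connected_def)
  \<comment> \<open>Connectedness speaks about the symmetric closure; the arcs are symmetric
    already, so reachability is the same.\<close>
  then have "reachable (with_proj G) u v"
    using reachable_mk_symmetric_eq[OF sym_arcs] by simp
  then obtain p where "awalk u p v"
    using reachable_awalk by auto
  then show ?thesis
    using that awalk_length_iff_relpow[OF assms(1)] by blast
qed

lemma
  assumes "u \<in> pverts G" "v \<in> pverts G"
  shows relpow_graph_dist: "(u, v) \<in> parcs G ^^ graph_dist G u v"
    and graph_dist_le: "(u, v) \<in> parcs G ^^ n \<Longrightarrow> graph_dist G u v \<le> n"
proof -
  obtain m where "(u, v) \<in> parcs G ^^ m" using relpow_connected[OF assms] by blast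
  then show "(u, v) \<in> parcs G ^^ graph_dist G u v"
    unfolding graph_dist_relpow[OF assms(1)] by (rule LeastI)
  show "(u, v) \<in> parcs G ^^ n \<Longrightarrow> graph_dist G u v \<le> n"
    unfolding graph_dist_relpow[OF assms(1)] by (rule Least_le)
qed

text \<open>Acyclicity in terms of vertex sequences, which later arguments produce more easily than
  arc walks.\<close>

lemma no_simple_cycle:
  assumes n: "3 \<le> n" and closed: "g n = g 0"
    and arcs: "\<And>i. i < n \<Longrightarrow> (g i, g (Suc i)) \<in> parcs G"
    and inj: "inj_on g {..<n}"
  shows False
proof -
  \<comment> \<open>The suffix from \<open>k\<close> on serves the downward induction for
    \<open>cas\<close>; the cycle itself is \<open>p 0\<close>.\<close>
  define p where "p k = map (\<lambda>i. (g i, g (Suc i))) [k..<n]" for k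
  have cas: "pcas (g k) (p k) (g n)" if "k \<le> n" for k
    using that
  proof (induction k rule: inc_induct)
    case base
    then show ?case by (simp add: p_def)
  next
    case (step k)
    then show ?case by (simp add: p_def upt_conv_Cons)
  qed
  have snd_p: "map snd (p 0) = map (\<lambda>i. g (Suc i)) [0..<n]"
    by (simp add: p_def)
  have "inj_on (\<lambda>i. g (Suc i)) {..<n}"
  proof (rule inj_onI)
    fix i j assume ij: "i \<in> {..<n}" "j \<in> {..<n}" "g (Suc i) = g (Suc j)"
    \<comment> \<open>\<open>r\<close> is the cyclic successor: \<open>g (Suc i) = g (r i)\<close>
      because \<open>g n = g 0\<close>. This carries injectivity from the indices 0, ..., n - 1 over
      to 1, ..., n, which \<open>cycle\<close> asks for.\<close>
    define r where "r i = (if Suc i = n then 0 else Suc i)" for i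
    have "g (r i) = g (r j)" "r i < n" "r j < n"
      using ij n closed by (auto simp: r_def)
    then have "r i = r j" using inj by (auto dest: inj_onD)
    then show "i = j" by (auto simp: r_def split: if_splits)
  qed
  then have "distinct (tl (pawalk_verts (g 0) (p 0)))"
    using pawalk_verts_tl[OF cas[of 0]]
    by (simp add: snd_p distinct_map lessThan_atLeast0)
  moreover have "awalk (g 0) (p 0) (g 0)"
    using in_arcsD1[OF arcs[of 0]] arcs n cas[of 0] closed by (auto simp: awalk_def p_def)
  ultimately have "cycle (p 0)"
    using n by (auto simp: cycle_def p_def)
  then show False
    using acyclic[of "p 0"] n by (simp add: p_def)
qed

lemma no_triangle: "(a, b) \<in> parcs G \<Longrightarrow> (b, c) \<in> parcs G \<Longrightarrow> (c, a) \<notin> parcs G"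
proof
  assume arcs: "(a, b) \<in> parcs G" "(b, c) \<in> parcs G" "(c, a) \<in> parcs G"
  define g where "g i = (if i = 1 then b else if i = 2 then c else a)" for i :: nat
  have "a \<noteq> b" "b \<noteq> c" "c \<noteq> a"
    using arcs pair_no_loops by fastforce+
  then show False
    using arcs by (intro no_simple_cycle[of 3 g])
      (auto simp: g_def inj_on_def numeral_3_eq_3 less_Suc_eq)
qed

text \<open>Otherwise the four vertices would form a simple cycle. Hence two distinct vertices share
  at most one neighbour.\<close>

lemma common_neighbour_unique:
  assumes "(a, b) \<in> parcs G" "(b, c) \<in> parcs G" "(c, d) \<in> parcs G" "(d, a) \<in> parcs G"
  shows "a = c \<or> b = d"
proof (rule ccontr)
  assume neq: "\<not> (a = c \<or> b = d)"
  define g where "g i = (if i = 1 then b else if i = 2 then c else if i = 3 then d else a)"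
    for i :: nat
  have "a \<noteq> b" "b \<noteq> c" "c \<noteq> d" "d \<noteq> a"
    using assms pair_no_loops by fastforce+
  then show False
    using assms neq by (intro no_simple_cycle[of 4 g])
      (auto simp: g_def inj_on_def eval_nat_numeral less_Suc_eq)
qed

text \<open>A common neighbour of distinct vertices gives a walk of length 2; distance 1 would close
  a triangle, and a second common neighbour a 4-cycle. For constant degree the kernel of the squared
  adjacency operator is therefore a function of the distance.\<close>

lemma card_common_neighbours:
  assumes x: "x \<in> pverts G" and y: "y \<in> pverts G"
  shows "card (neighbours G x \<inter> neighbours G y) =
    (if graph_dist G x y = 0 then card (neighbours G x)
     else if graph_dist G x y = 2 then 1 else 0)"
proof -
  have walk: "(x, y) \<in> parcs G ^^ graph_dist G x y"
    using relpow_graph_dist[OF assms] .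
  show ?thesis
  proof (cases "neighbours G x \<inter> neighbours G y = {}")
    case True
    have "graph_dist G x y \<noteq> 2"
    proof
      assume "graph_dist G x y = 2"
      then obtain w where "(x, w) \<in> parcs G" "(w, y) \<in> parcs G"
        using walk by (auto simp: numeral_2_eq_2)
      then show False using True arcs_symmetric by (auto simp: neighbours_def)
    qed
    moreover have "graph_dist G x y = 0 \<Longrightarrow> x = y"
      using walk by simp
    ultimately show ?thesis using True by auto
  next
    case False
    then obtain w where w: "(x, w) \<in> parcs G" "(y, w) \<in> parcs G"
      by (auto simp: neighbours_def)
    have wy: "(w, y) \<in> parcs G" using w(2) by (rule arcs_symmetric)
    show ?thesis
    proof (cases "x = y")
      case True
      then have "graph_dist G x y \<le> 0"
        using graph_dist_le[OF assms, of 0] by simp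
      then show ?thesis using True by simp
    next
      case neq: False
      have "graph_dist G x y \<le> 2"
        using graph_dist_le[OF assms, of 2] w wy by (auto simp: numeral_2_eq_2)
      moreover have "graph_dist G x y \<noteq> 0"
        using walk neq by (metis pair_in_Id_conv relpow.simps(1))
      moreover have "graph_dist G x y \<noteq> 1"
        using walk no_triangle[OF w(1) wy] arcs_symmetric by (metis relpow_1)
      ultimately have "graph_dist G x y = 2" by linarith
      moreover have "neighbours G x \<inter> neighbours G y = {w}"
        using w wy neq arcs_symmetric common_neighbour_unique[of x w y]
        by (auto simp: neighbours_def)
      ultimately show ?thesis by simp
    qed
  qed
qed

end

section \<open>Coverings of trees\<close>

text \<open>A covering map in the topological sense, bijective on every star. Between trees it turns
  out to be an isometric bijection, which yields the uniqueness of the homogeneous tree.\<close>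

locale tree_covering =
  G: undirected_tree G + H: undirected_tree H
  for G :: "'a pair_pre_digraph" and H :: "'b pair_pre_digraph" +
  fixes f :: "'a \<Rightarrow> 'b"
  assumes f_verts: "x \<in> pverts G \<Longrightarrow> f x \<in> pverts H"
    and f_neighbours: "x \<in> pverts G \<Longrightarrow> bij_betw f (neighbours G x) (neighbours H (f x))"
begin

lemma f_arc: "(x, y) \<in> parcs G \<Longrightarrow> (f x, f y) \<in> parcs H"
  using f_neighbours[of x] G.in_arcsD1 by (auto simp: neighbours_def bij_betw_def)

lemma f_locally_inj: "(x, y) \<in> parcs G \<Longrightarrow> (x, z) \<in> parcs G \<Longrightarrow> f y = f z \<Longrightarrow> y = z"
  using f_neighbours[of x] G.in_arcsD1 by (auto simp: neighbours_def bij_betw_def inj_on_def)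

lemma f_relpow: "(x, y) \<in> parcs G ^^ n \<Longrightarrow> (f x, f y) \<in> parcs H ^^ n"
  by (induction n arbitrary: y) (auto dest: f_arc)

text \<open>Path lifting: surjectivity on stars lifts a walk arc by arc from a prescribed starting
  point.\<close>

lemma f_lift:
  "x \<in> pverts G \<Longrightarrow> (f x, w) \<in> parcs H ^^ n \<Longrightarrow> \<exists>y. (x, y) \<in> parcs G ^^ n \<and> f y = w"
proof (induction n arbitrary: w)
  case (Suc n)
  then obtain y where y: "(x, y) \<in> parcs G ^^ n" "(f y, w) \<in> parcs H"
    by auto
  then have "w \<in> f ` neighbours G y"
    using f_neighbours[of y] G.relpow_in_verts Suc.prems
    by (auto simp: bij_betw_def neighbours_def)
  with y show ?case by (auto simp: neighbours_def)
qed auto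

lemma f_surj: "f ` pverts G = pverts H"
proof
  obtain x where x: "x \<in> pverts G" using G.verts_nonempty by auto
  show "pverts H \<subseteq> f ` pverts G"
  proof
    fix w assume "w \<in> pverts H"
    then obtain n where "(f x, w) \<in> parcs H ^^ n"
      using H.relpow_connected f_verts x by metis
    then show "w \<in> f ` pverts G"
      using f_lift x G.relpow_in_verts by blast
  qed
qed (use f_verts in auto)

text \<open>A shortest walk in G between two distinct points of one fibre would map to a simple cycle.\<close>

lemma f_inj: "inj_on f (pverts G)"
proof (rule ccontr)
  let ?P = "\<lambda>n. \<exists>x\<in>pverts G. \<exists>y\<in>pverts G. x \<noteq> y \<and> f x = f y \<and> (x, y) \<in> parcs G ^^ n"
  assume "\<not> inj_on f (pverts G)"
  then have ex: "\<exists>n. ?P n"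
    unfolding inj_on_def by (metis G.relpow_connected)
  define n where "n = (LEAST n. ?P n)"
  have "?P n" unfolding n_def using ex by (rule LeastI_ex)
  then obtain x y where xy: "x \<in> pverts G" "y \<in> pverts G" "x \<noteq> y" "f x = f y"
    "(x, y) \<in> parcs G ^^ n" by blast
  have minimal: "u = v" if "u \<in> pverts G" "f u = f v" "(u, v) \<in> parcs G ^^ m" "m < n" for u v m
    using not_less_Least[of m ?P] that G.relpow_in_verts unfolding n_def by blast
  obtain g where g: "g 0 = x" "g n = y" "\<And>i. i < n \<Longrightarrow> (g i, g (Suc i)) \<in> parcs G"
    using xy(5) unfolding relpow_fun_conv by blast
  have seg: "(g i, g j) \<in> parcs G ^^ (j - i)" if "i \<le> j" "j \<le> n" for i j
    using that g(3) unfolding relpow_fun_conv by (intro exI[of _ "\<lambda>k. g (i + k)"]) auto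
  \<comment> \<open>Lengths below 3 are excluded separately: 0 since x and y differ, 1 since the
    image arc would be a loop, 2 by injectivity on the star of the midpoint.\<close>
  have "n \<noteq> 0" using xy by (intro notI) simp
  moreover have "n \<noteq> 1" using g xy H.pair_no_loops f_arc by fastforce
  moreover have "n \<noteq> 2"
  proof
    assume "n = 2"
    then have "(x, g 1) \<in> parcs G" "(g 1, y) \<in> parcs G"
      using g(1,2) g(3)[of 0] g(3)[of 1] by (auto simp: numeral_2_eq_2)
    then show False using f_locally_inj G.arcs_symmetric xy by metis
  qed
  ultimately have "3 \<le> n" by linarith
  moreover have "inj_on (\<lambda>i. f (g i)) {..<n}"
  proof (rule linorder_inj_onI)
    fix i j assume ij: "i < j" "i \<in> {..<n}" "j \<in> {..<n}"
    show "f (g i) \<noteq> f (g j)"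
    proof
      assume eq: "f (g i) = f (g j)"
      have "g i \<in> pverts G" using g(3)[of i] ij G.in_arcsD1 by auto
      \<comment> \<open>The segment from i to j is shorter than n, so minimality makes its ends
        equal. Cutting it out leaves a walk from x to y that is again shorter than n.\<close>
      then have "g i = g j" using minimal[OF _ eq seg[of i j]] ij by auto
      then have "(x, g j) \<in> parcs G ^^ i"
        using seg[of 0 i] g(1) ij by simp
      then have "(x, y) \<in> parcs G ^^ (i + (n - j))"
        unfolding relpow_add using seg[of j n] g(2) ij by auto
      then have "x = y" using minimal[OF xy(1,4)] ij by auto
      then show False using xy by simp
    qed
  qed auto
  ultimately show False
    using H.no_simple_cycle[of n "\<lambda>i. f (g i)"] g xy f_arc by simp
qed

text \<open>Walks of each length correspond: they push forward along \<open>f\<close>, and a walk to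
  \<open>f y\<close> lifts to one that ends at \<open>y\<close> by injectivity.\<close>

lemma f_dist:
  assumes "x \<in> pverts G" "y \<in> pverts G"
  shows "graph_dist H (f x) (f y) = graph_dist G x y"
proof -
  have "(f x, f y) \<in> parcs H ^^ n \<longleftrightarrow> (x, y) \<in> parcs G ^^ n" for n
  proof
    assume "(f x, f y) \<in> parcs H ^^ n"
    then obtain z where "(x, z) \<in> parcs G ^^ n" "f z = f y"
      using f_lift assms by blast
    then show "(x, y) \<in> parcs G ^^ n"
      using f_inj assms G.relpow_in_verts by (metis inj_onD)
  qed (rule f_relpow)
  then show ?thesis
    using assms f_verts by (simp add: G.graph_dist_relpow H.graph_dist_relpow)
qed

end

section \<open>Word trees\<close>

lemma undirected_word_tree: "undirected_tree (word_tree q)"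
  using is_T_word_tree unfolding is_T_def homogeneous_tree_def by blast

lemma pverts_word_tree [simp]: "pverts (word_tree q) = {xs. word q xs}"
  by (simp add: word_tree_def)

lemma neighbours_word_tree_Nil: "neighbours (word_tree q) [] = (\<lambda>i. [i]) ` {..<q + 1}"
  by (auto simp: neighbours_def word_tree_def)

lemma neighbours_word_tree_Cons:
  "word q (j # ys) \<Longrightarrow>
    neighbours (word_tree q) (j # ys) = insert ys ((\<lambda>i. i # j # ys) ` {..<q})"
  by (auto simp: neighbours_def word_tree_def)

text \<open>An arbitrary but fixed numbering of a finite set; it tells \<open>word_vertex\<close>
  which neighbour a letter selects.\<close>

definition enum :: "'a set \<Rightarrow> nat \<Rightarrow> 'a" where
  "enum A = (SOME h. bij_betw h {0..<card A} A)"

lemma bij_betw_enum: "finite A \<Longrightarrow> bij_betw (enum A) {..<card A} A"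
  unfolding enum_def lessThan_atLeast0 by (rule someI_ex[OF ex_bij_betw_nat_finite])

text \<open>Reads a word from its last letter to its first as a walk from \<open>r\<close> that
  never turns back: away from the root, the vertex just left is removed before the next letter
  selects a neighbour.\<close>

fun word_vertex :: "'a pair_pre_digraph \<Rightarrow> 'a \<Rightarrow> nat list \<Rightarrow> 'a" where
  "word_vertex G r [] = r"
| "word_vertex G r [i] = enum (neighbours G r) i"
| "word_vertex G r (i # j # xs) =
    enum (neighbours G (word_vertex G r (j # xs)) - {word_vertex G r xs}) i"

lemma is_T_covering:
  assumes "is_T q G" and r: "r \<in> pverts G"
  shows "tree_covering (word_tree q) G (word_vertex G r)"
proof -
  interpret G: undirected_tree G
    using assms by (simp add: is_T_def homogeneous_tree_def)
  have card: "card (neighbours G v) = q + 1" if "v \<in> pverts G" for v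
    using assms that out_degree_eq_card_neighbours[of G v]
    by (simp add: is_T_def homogeneous_tree_def)
  then have fin: "finite (neighbours G v)" if "v \<in> pverts G" for v
    using that card_ge_0_finite[of "neighbours G v"] by simp
  let ?f = "word_vertex G r"
  have root: "bij_betw (\<lambda>i. ?f [i]) {..<q + 1} (neighbours G r)"
    using bij_betw_enum[OF fin[OF r]] card[OF r] by simp
  have step: "bij_betw (\<lambda>i. ?f (i # j # ys)) {..<q} (neighbours G (?f (j # ys)) - {?f ys})"
    if "?f (j # ys) \<in> pverts G" "(?f (j # ys), ?f ys) \<in> parcs G" for j ys
    using bij_betw_enum[of "neighbours G (?f (j # ys)) - {?f ys}"] card fin that
    by (simp add: neighbours_def)
  \<comment> \<open>Adjacency to the image of the tail is carried along because removing that vertex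
    must leave exactly q neighbours for the q letters.\<close>
  have f: "?f xs \<in> pverts G \<and> (xs \<noteq> [] \<longrightarrow> (?f xs, ?f (tl xs)) \<in> parcs G)"
    if "word q xs" for xs
    using that
  proof (induction xs rule: induct_list012)
    case 1
    then show ?case using r by simp
  next
    case (2 i)
    then have "?f [i] \<in> neighbours G r"
      using bij_betwE[OF root] by auto
    then show ?case
      by (auto simp: neighbours_def G.arcs_symmetric dest: G.in_arcsD2 simp del: word_vertex.simps(2))
  next
    case (3 i j ys)
    then have "?f (i # j # ys) \<in> neighbours G (?f (j # ys)) - {?f ys}"
      using bij_betwE[OF step[of j ys]] by auto
    then show ?case
      by (auto simp: neighbours_def G.arcs_symmetric dest: G.in_arcsD2 simp del: word_vertex.simps(3))
  qed
  show ?thesis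
  proof (intro tree_covering.intro undirected_word_tree G.undirected_tree_axioms
      tree_covering_axioms.intro)
    fix xs assume "xs \<in> pverts (word_tree q)"
    then have xs: "word q xs" by simp
    show "?f xs \<in> pverts G" using f xs by blast
    show "bij_betw ?f (neighbours (word_tree q) xs) (neighbours G (?f xs))"
    proof (cases xs)
      case Nil
      have "bij_betw ?f ((\<lambda>i. [i]) ` {..<q + 1}) (neighbours G r)"
        using root by (intro bij_betw_imageI) (auto simp: bij_betw_def inj_on_def image_image)
      then show ?thesis using Nil neighbours_word_tree_Nil by simp
    next
      case (Cons j ys)
      have arc: "(?f (j # ys), ?f ys) \<in> parcs G" "?f (j # ys) \<in> pverts G"
        using f[OF xs] Cons by auto
      have "bij_betw ?f ((\<lambda>i. i # j # ys) ` {..<q}) (neighbours G (?f xs) - {?f ys})"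
        using step[OF arc(2,1)] Cons
        by (intro bij_betw_imageI)
           (auto simp: bij_betw_def inj_on_def image_image simp del: word_vertex.simps)
      moreover have "bij_betw ?f {ys} {?f ys}" by simp
      ultimately have "bij_betw ?f ({ys} \<union> (\<lambda>i. i # j # ys) ` {..<q})
          ({?f ys} \<union> (neighbours G (?f xs) - {?f ys}))"
        by (intro bij_betw_combine) auto
      moreover have "{?f ys} \<union> (neighbours G (?f xs) - {?f ys}) = neighbours G (?f xs)"
        using arc Cons by (auto simp: neighbours_def)
      ultimately show ?thesis
        using neighbours_word_tree_Cons[of q j ys] xs Cons by simp
    qed
  qed
qed

text \<open>Lowers each letter that is too large to the largest admissible one. Tails are respected,
  so arcs of a larger word tree go to arcs, and words of the smaller tree stay fixed: a
  retraction.\<close>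

fun fold_word :: "nat \<Rightarrow> nat list \<Rightarrow> nat list" where
  "fold_word q [] = []"
| "fold_word q (i # xs) = min i (if xs = [] then q else q - 1) # fold_word q xs"

lemma fold_word_eq_Nil_iff [simp]: "fold_word q xs = [] \<longleftrightarrow> xs = []"
  by (cases xs) auto

lemma word_fold_word: "0 < q \<Longrightarrow> word q (fold_word q xs)"
  by (induction xs) auto

lemma fold_word_id: "word q xs \<Longrightarrow> fold_word q xs = xs"
  by (induction xs) (auto split: if_splits)

lemma word_mono: "word q xs \<Longrightarrow> q \<le> q' \<Longrightarrow> word q' xs"
  by (induction xs) (auto split: if_splits)

text \<open>The distances agree because the smaller tree is a retract of the larger one.\<close>

lemma graph_dist_word_tree_mono:
  assumes "0 < q" "q \<le> q'" "word q xs" "word q ys"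
  shows "graph_dist (word_tree q') xs ys = graph_dist (word_tree q) xs ys"
proof -
  interpret A: undirected_tree "word_tree q" by (rule undirected_word_tree)
  interpret B: undirected_tree "word_tree q'" by (rule undirected_word_tree)
  have "parcs (word_tree q) \<subseteq> parcs (word_tree q')"
    using word_mono[OF _ assms(2)] by (auto simp: word_tree_def)
  then have up: "(u, v) \<in> parcs (word_tree q) ^^ n \<Longrightarrow> (u, v) \<in> parcs (word_tree q') ^^ n" for u v n
    by (induction n arbitrary: v) auto
  have "(u, v) \<in> parcs (word_tree q') \<Longrightarrow>
      (fold_word q u, fold_word q v) \<in> parcs (word_tree q)" for u v
    using word_fold_word[OF assms(1)] by (auto simp: word_tree_def simp del: word.simps)
  then have "(u, v) \<in> parcs (word_tree q') ^^ n \<Longrightarrow>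
      (fold_word q u, fold_word q v) \<in> parcs (word_tree q) ^^ n" for u v n
    by (induction n arbitrary: v) auto
  from this[of xs ys] up[of xs ys]
  have "(xs, ys) \<in> parcs (word_tree q') ^^ n \<longleftrightarrow> (xs, ys) \<in> parcs (word_tree q) ^^ n" for n
    using assms fold_word_id by auto
  moreover have "word q' xs" using assms word_mono by blast
  ultimately show ?thesis
    using assms by (simp add: A.graph_dist_relpow B.graph_dist_relpow)
qed

section \<open>Positive definite functions\<close>

text \<open>Families may repeat points, so each member of a family in the image can be replaced by a
  preimage independently of the others.\<close>

lemma positive_definite_on_image:
  "positive_definite_on (f ` X) \<psi> \<longleftrightarrow> positive_definite_on X (\<lambda>x y. \<psi> (f x) (f y))"
proof
  assume L: "positive_definite_on (f ` X) \<psi>"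
  then show "positive_definite_on X (\<lambda>x y. \<psi> (f x) (f y))"
    unfolding positive_definite_on_def
  proof (intro allI impI)
    fix n x z assume x: "\<forall>i<(n::nat). x i \<in> X"
    show "(\<Sum>i<n. \<Sum>j<n. \<psi> (f (x i)) (f (x j)) * cnj (z i) * z j) \<in> \<real>\<^sub>\<ge>\<^sub>0"
      using L[unfolded positive_definite_on_def, rule_format, of n "\<lambda>i. f (x i)" z] x by auto
  qed
next
  assume R: "positive_definite_on X (\<lambda>x y. \<psi> (f x) (f y))"
  show "positive_definite_on (f ` X) \<psi>"
    unfolding positive_definite_on_def
  proof (intro allI impI)
    fix n x z assume "\<forall>i<(n::nat). x i \<in> f ` X"
    then have "\<forall>i<n. \<exists>y\<in>X. x i = f y" by auto
    then obtain y where y: "\<And>i. i < n \<Longrightarrow> y i \<in> X \<and> x i = f (y i)" by metis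
    then show "(\<Sum>i<n. \<Sum>j<n. \<psi> (x i) (x j) * cnj (z i) * z j) \<in> \<real>\<^sub>\<ge>\<^sub>0"
      using R[unfolded positive_definite_on_def, rule_format, of n y z] by simp
  qed
qed

lemma positive_definite_on_subset:
  "positive_definite_on X \<psi> \<Longrightarrow> Y \<subseteq> X \<Longrightarrow> positive_definite_on Y \<psi>"
  unfolding positive_definite_on_def by blast

lemma positive_definite_on_cong:
  assumes "\<And>x y. x \<in> X \<Longrightarrow> y \<in> X \<Longrightarrow> \<psi> x y = \<psi>' x y"
  shows "positive_definite_on X \<psi> \<longleftrightarrow> positive_definite_on X \<psi>'"
proof -
  have "((\<Sum>i<n. \<Sum>j<n. \<psi> (x i) (x j) * cnj (z i) * z j) \<in> \<real>\<^sub>\<ge>\<^sub>0) =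
      ((\<Sum>i<n. \<Sum>j<n. \<psi>' (x i) (x j) * cnj (z i) * z j) \<in> \<real>\<^sub>\<ge>\<^sub>0)"
    if "\<forall>i<n. x i \<in> X" for n x z
    using that assms by simp
  then show ?thesis
    unfolding positive_definite_on_def by (intro iff_allI imp_cong refl)
qed

text \<open>Passes from indexed complex families to real weights on a finite set, the form in which
  the test vector is evaluated.\<close>

lemma positive_definite_on_finite_sum:
  assumes "positive_definite_on X (\<lambda>x y. complex_of_real (\<psi> x y))" "finite A" "A \<subseteq> X"
  shows "0 \<le> (\<Sum>x\<in>A. \<Sum>y\<in>A. \<psi> x y * z x * z y)"
proof -
  obtain h where h: "bij_betw h {..<card A} A"
    using bij_betw_enum[OF assms(2)] by blast
  have sum_h: "(\<Sum>x\<in>A. g x) = (\<Sum>i<card A. g (h i))" for g :: "'a \<Rightarrow> real"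
    using sum.reindex_bij_betw[OF h, of g] by simp
  have "\<forall>i<card A. h i \<in> X"
    using assms(3) bij_betwE[OF h] by auto
  then have "(\<Sum>i<card A. \<Sum>j<card A. complex_of_real (\<psi> (h i) (h j)) *
      cnj (complex_of_real (z (h i))) * complex_of_real (z (h j))) \<in> \<real>\<^sub>\<ge>\<^sub>0"
    using assms(1)[unfolded positive_definite_on_def, rule_format,
        of "card A" h "\<lambda>i. complex_of_real (z (h i))"] by blast
  also have "(\<Sum>i<card A. \<Sum>j<card A. complex_of_real (\<psi> (h i) (h j)) *
      cnj (complex_of_real (z (h i))) * complex_of_real (z (h j))) =
      complex_of_real (\<Sum>i<card A. \<Sum>j<card A. \<psi> (h i) (h j) * z (h i) * z (h j))"
    by simp
  finally show ?thesis
    by (simp only: sum_h nonneg_Reals_of_real_iff)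
qed

lemma card_Int_eq_sum_of_bool:
  assumes "finite W" "A \<subseteq> W"
  shows "of_nat (card (A \<inter> B)) =
    (\<Sum>w\<in>W. of_bool (w \<in> A) * of_bool (w \<in> B) :: 'b :: semiring_1)"
proof -
  have "W \<inter> {w. w \<in> A \<and> w \<in> B} = A \<inter> B" using assms(2) by auto
  then show ?thesis using assms(1) by (simp flip: of_bool_conj)
qed

text \<open>A Gram kernel: the cardinality is the inner product of the indicator functions of
  \<open>N x\<close> and \<open>N y\<close>, so the quadratic form is the squared norm of their
  combination with coefficients \<open>z\<close>.\<close>

lemma positive_definite_on_card_Int:
  assumes "\<And>x. x \<in> X \<Longrightarrow> finite (N x)"
  shows "positive_definite_on X (\<lambda>x y. of_nat (card (N x \<inter> N y)))"
  unfolding positive_definite_on_def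
proof (intro allI impI)
  fix n x and z :: "nat \<Rightarrow> complex" assume x: "\<forall>i<(n::nat). x i \<in> X"
  define W where "W = (\<Union>i<n. N (x i))"
  define s where "s w = (\<Sum>i<n. of_bool (w \<in> N (x i)) * z i)" for w
  have W: "finite W" using assms x by (auto simp: W_def)
  have "(\<Sum>i<n. \<Sum>j<n. of_nat (card (N (x i) \<inter> N (x j))) * cnj (z i) * z j) =
      (\<Sum>i<n. \<Sum>j<n. \<Sum>w\<in>W. of_bool (w \<in> N (x i)) * of_bool (w \<in> N (x j)) * cnj (z i) * z j)"
    by (intro sum.cong refl, subst card_Int_eq_sum_of_bool[OF W])
       (auto simp: W_def sum_distrib_right)
  also have "\<dots> = (\<Sum>w\<in>W. \<Sum>i<n. \<Sum>j<n. of_bool (w \<in> N (x i)) * of_bool (w \<in> N (x j)) * cnj (z i) * z j)"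
    by (simp only: sum.swap[where B = W])
  also have "\<dots> = (\<Sum>w\<in>W. cnj (s w) * s w)"
    unfolding s_def cnj_sum sum_product by (intro sum.cong refl) (simp add: mult_ac)
  also have "\<dots> = complex_of_real (\<Sum>w\<in>W. (cmod (s w))\<^sup>2)"
    by (simp add: mult.commute[of "cnj _"] complex_norm_square del: of_real_power)
  finally show "(\<Sum>i<n. \<Sum>j<n. of_nat (card (N (x i) \<inter> N (x j))) * cnj (z i) * z j) \<in> \<real>\<^sub>\<ge>\<^sub>0"
    by (simp only: nonneg_Reals_of_real_iff) (simp add: sum_nonneg)
qed

text \<open>The covering by the word tree is a surjective isometry. All further work can thus take
  place on word trees, whatever the vertex types of the given trees.\<close>

lemma R_plus_is_T:
  assumes "is_T q G"
  shows "R_plus G = R_plus (word_tree q)"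
proof -
  interpret G: undirected_tree G
    using assms by (simp add: is_T_def homogeneous_tree_def)
  obtain r where "r \<in> pverts G" using G.verts_nonempty by auto
  then have cover: "tree_covering (word_tree q) G (word_vertex G r)"
    by (rule is_T_covering[OF assms])
  have "positive_definite_on (pverts G) (\<lambda>x y. \<phi> (graph_dist G x y)) \<longleftrightarrow>
      positive_definite_on (pverts (word_tree q)) (\<lambda>x y. \<phi> (graph_dist (word_tree q) x y))" for \<phi>
    unfolding tree_covering.f_surj[OF cover, symmetric] positive_definite_on_image
    by (rule positive_definite_on_cong) (simp add: tree_covering.f_dist[OF cover])
  then show ?thesis by (simp add: R_plus_def)
qed

lemma R_plus_word_tree_mono:
  assumes "0 < q" "q \<le> q'"
  shows "R_plus (word_tree q') \<subseteq> R_plus (word_tree q)"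
proof
  fix \<phi> assume "\<phi> \<in> R_plus (word_tree q')"
  then have "positive_definite_on {xs. word q xs} (\<lambda>x y. \<phi> (graph_dist (word_tree q') x y))"
    unfolding R_plus_def using word_mono[OF _ assms(2)]
    by (auto elim!: positive_definite_on_subset)
  then show "\<phi> \<in> R_plus (word_tree q)"
    using positive_definite_on_cong[of "{xs. word q xs}"
        "\<lambda>x y. \<phi> (graph_dist (word_tree q') x y)" "\<lambda>x y. \<phi> (graph_dist (word_tree q) x y)"]
      graph_dist_word_tree_mono[OF assms] by (simp add: R_plus_def)
qed

section \<open>A function separating consecutive trees\<close>

definition common_neighbours_function :: "nat \<Rightarrow> nat \<Rightarrow> real" where
  "common_neighbours_function q n = (if n = 0 then q + 1 else if n = 2 then 1 else 0)"

lemma card_neighbours_word_tree: "word q x \<Longrightarrow> card (neighbours (word_tree q) x) = q + 1"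
  using degree_word_tree out_degree_eq_card_neighbours by metis

lemma card_common_neighbours_word_tree:
  assumes "word q x" "word q y"
  shows "common_neighbours_function q (graph_dist (word_tree q) x y) =
    card (neighbours (word_tree q) x \<inter> neighbours (word_tree q) y)"
  using undirected_tree.card_common_neighbours[OF undirected_word_tree[of q], of x y] assms
  by (simp add: card_neighbours_word_tree common_neighbours_function_def)

lemma common_neighbours_function_in_R_plus:
  "(\<lambda>n. complex_of_real (common_neighbours_function q n)) \<in> R_plus (word_tree q)"
proof -
  have "finite (neighbours (word_tree q) x)" if "word q x" for x
    using card_neighbours_word_tree[OF that] card_ge_0_finite by force
  then have "positive_definite_on {x. word q x} (\<lambda>x y. complex_of_nat
      (card (neighbours (word_tree q) x \<inter> neighbours (word_tree q) y)))"
    by (intro positive_definite_on_card_Int) auto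
  then show ?thesis
    using positive_definite_on_cong[of "{x. word q x}" "\<lambda>x y. complex_of_nat
      (card (neighbours (word_tree q) x \<inter> neighbours (word_tree q) y))"
      "\<lambda>x y. complex_of_real (common_neighbours_function q (graph_dist (word_tree q) x y))"]
    by (simp add: R_plus_def card_common_neighbours_word_tree)
qed

section \<open>Spheres about the empty word\<close>

definition words :: "nat \<Rightarrow> nat \<Rightarrow> nat list set" where
  "words q n = {xs. word q xs \<and> length xs = n}"

lemma words_0 [simp]: "words q 0 = {[]}"
  by (auto simp: words_def)

lemma words_1: "words q (Suc 0) = (\<lambda>i. [i]) ` {..<q + 1}"
  by (auto simp: words_def length_Suc_conv)

lemma words_Suc_Suc:
  "words q (Suc (Suc n)) = (\<lambda>(i, xs). i # xs) ` ({..<q} \<times> words q (Suc n))"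
  by (auto simp: words_def length_Suc_conv)

lemma finite_words: "finite (words q n)"
proof (induction n rule: induct_nat_012)
  case 1
  then show ?case by (simp only: words_1) simp
qed (auto simp: words_Suc_Suc)

text \<open>The last letter of a word has q + 1 choices, every earlier one has q.\<close>

lemma card_words_Suc: "card (words q (Suc n)) = (q + 1) * q ^ n"
proof (induction n)
  case 0
  show ?case by (simp add: words_1 card_image inj_on_def del: lessThan_Suc)
next
  case (Suc n)
  have "card (words q (Suc (Suc n))) = card ({..<q} \<times> words q (Suc n))"
    unfolding words_Suc_Suc by (rule card_image) (auto simp: inj_on_def)
  then show ?case using Suc by (simp add: card_cartesian_product algebra_simps)
qed

lemma sum_words_UN:
  fixes g :: "nat list \<Rightarrow> real" and h :: "nat \<Rightarrow> nat"
  assumes "inj h"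
  shows "(\<Sum>x\<in>(\<Union>k\<le>m. words q (h k)). g x) = (\<Sum>k\<le>m. \<Sum>x\<in>words q (h k). g x)"
proof (rule sum.UNION_disjoint)
  show "\<forall>i\<in>{..m}. \<forall>j\<in>{..m}. i \<noteq> j \<longrightarrow> words q (h i) \<inter> words q (h j) = {}"
    using assms by (auto simp: words_def dest: injD)
qed (simp_all add: finite_words)

text \<open>
  The test vector truncates the radial function annihilated by A on the larger tree. Its image
  under A lives on the boundary sphere, with squared norm \<open>Q + 1\<close>, whereas each even
  sphere adds \<open>(Q + 1) / Q\<close> to its own squared norm, which is \<open>Q + 2\<close> after Q spheres.
\<close>

lemma common_neighbours_function_notin_R_plus:
  "(\<lambda>n. complex_of_real (common_neighbours_function q n)) \<notin> R_plus (word_tree (q + 1))"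
proof
  assume pd: "(\<lambda>n. complex_of_real (common_neighbours_function q n))
      \<in> R_plus (word_tree (q + 1))"
  define Q where "Q = q + 1"
  define N where "N = neighbours (word_tree Q)"
  \<comment> \<open>\<open>A\<close> is the union of the even spheres up to radius 2Q. The cutoff Q
    is the least m for which the squared norm 1 + m (Q + 1) / Q exceeds the boundary term Q +
    1.\<close>
  define A where "A = (\<Union>k\<le>Q. words Q (2 * k))"
  define W where "W = (\<Union>k\<le>Q. words Q (Suc (2 * k)))"
  \<comment> \<open>A word of length 2k + 1 has one neighbour of length 2k and Q of length 2k + 2;
    the ratio -1/Q between consecutive even spheres makes these contributions cancel.\<close>
  define z where "z xs = (- 1 / real Q) ^ (length xs div 2)" for xs :: "nat list"
  \<comment> \<open>\<open>s\<close> is the image of the truncated \<open>z\<close> under the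
    adjacency operator; by \<open>N_W\<close> it is supported in \<open>W\<close>.\<close>
  define s where "s w = (\<Sum>x\<in>A. of_bool (w \<in> N x) * z x)" for w
  have Q: "0 < Q" by (simp add: Q_def)
  have fin: "finite A" "finite W" by (auto simp: A_def W_def finite_words)
  have A_words: "word Q x" if "x \<in> A" for x using that by (auto simp: A_def words_def)
  have N_sym: "w \<in> N x \<longleftrightarrow> x \<in> N w" for w x
    by (auto simp: N_def neighbours_def word_tree_def)
  have N_W: "N x \<subseteq> W" if x: "x \<in> A" for x
  proof
    fix w assume "w \<in> N x"
    then have w: "word Q w" "length w = Suc (length x) \<or> length x = Suc (length w)"
      by (auto simp: N_def neighbours_def word_tree_def)
    obtain k where k: "k \<le> Q" "length x = 2 * k"
      using x by (auto simp: A_def words_def)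
    from w(2) show "w \<in> W"
    proof
      assume "length w = Suc (length x)"
      then show ?thesis using w k by (auto simp: W_def words_def)
    next
      assume "length x = Suc (length w)"
      \<comment> \<open>Here \<open>x\<close> is nonempty, so k is positive and k - 1 is its true
        predecessor.\<close>
      then have "length w = Suc (2 * (k - 1))" "k - 1 \<le> Q" using k by auto
      then show ?thesis using w(1) by (auto simp: W_def words_def)
    qed
  qed
  \<comment> \<open>At distance 0 the function takes the value Q, one less than the degree Q + 1 of
    \<open>word_tree Q\<close>; this deficit is the subtracted identity.\<close>
  have kernel: "common_neighbours_function q (graph_dist (word_tree Q) x y) =
      (\<Sum>w\<in>W. of_bool (w \<in> N x) * of_bool (w \<in> N y)) - of_bool (x = y)"
    if "x \<in> A" "y \<in> A" for x y
  proof -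
    interpret undirected_tree "word_tree Q" by (rule undirected_word_tree)
    have "graph_dist (word_tree Q) x y = 0 \<longleftrightarrow> x = y"
      using relpow_graph_dist[of x y] graph_dist_le[of x y 0] that A_words by auto
    then have "common_neighbours_function q (graph_dist (word_tree Q) x y) =
        common_neighbours_function Q (graph_dist (word_tree Q) x y) - of_bool (x = y)"
      by (simp add: common_neighbours_function_def Q_def)
    also have "common_neighbours_function Q (graph_dist (word_tree Q) x y) = card (N x \<inter> N y)"
      using that A_words by (simp add: card_common_neighbours_word_tree N_def)
    also have "\<dots> = (\<Sum>w\<in>W. of_bool (w \<in> N x) * of_bool (w \<in> N y))"
      by (rule card_Int_eq_sum_of_bool[OF fin(2) N_W[OF that(1)]])
    finally show ?thesis .
  qed
  have "0 \<le> (\<Sum>x\<in>A. \<Sum>y\<in>A.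
      common_neighbours_function q (graph_dist (word_tree Q) x y) * z x * z y)"
    using pd fin A_words by (intro positive_definite_on_finite_sum) (auto simp: R_plus_def Q_def)
  also have "\<dots> = (\<Sum>x\<in>A. \<Sum>y\<in>A.
      (\<Sum>w\<in>W. of_bool (w \<in> N x) * z x * (of_bool (w \<in> N y) * z y)) -
      of_bool (x = y) * z x * z y)"
    by (intro sum.cong refl, subst kernel)
       (simp_all only: left_diff_distrib right_diff_distrib sum_distrib_right sum_distrib_left mult_ac)
  also have "\<dots> = (\<Sum>w\<in>W. (s w)\<^sup>2) - (\<Sum>x\<in>A. (z x)\<^sup>2)"
  proof -
    have "(\<Sum>x\<in>A. \<Sum>y\<in>A. \<Sum>w\<in>W. of_bool (w \<in> N x) * z x * (of_bool (w \<in> N y) * z y)) =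
        (\<Sum>w\<in>W. (s w)\<^sup>2)"
      unfolding s_def power2_eq_square sum_product by (simp only: sum.swap[where B = W])
    moreover have "(\<Sum>x\<in>A. \<Sum>y\<in>A. of_bool (x = y) * z x * z y) = (\<Sum>x\<in>A. (z x)\<^sup>2)"
    proof (intro sum.cong refl)
      fix x assume "x \<in> A"
      have "(\<Sum>y\<in>A. of_bool (x = y) * z x * z y) = (\<Sum>y\<in>A. if x = y then z x * z y else 0)"
        by (intro sum.cong) auto
      also have "\<dots> = (z x)\<^sup>2"
        using fin \<open>x \<in> A\<close> by (simp add: power2_eq_square)
      finally show "(\<Sum>y\<in>A. of_bool (x = y) * z x * z y) = (z x)\<^sup>2" .
    qed
    ultimately show ?thesis by (simp only: sum_subtractf)
  qed
  also have "(\<Sum>w\<in>W. (s w)\<^sup>2) = Q + 1"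
  proof -
    \<comment> \<open>Cancellation fails only for k = Q, where the Q longer neighbours lie outside
      \<open>A\<close> and just the value of \<open>z\<close> at the tail \<open>ys\<close>
      remains.\<close>
    have s: "s w = (if k = Q then (- 1 / real Q) ^ Q else 0)"
      if w: "w \<in> words Q (Suc (2 * k))" and k: "k \<le> Q" for w k
    proof -
      obtain j ys where jys: "w = j # ys" "word Q w" "length ys = 2 * k"
        using w by (auto simp: words_def length_Suc_conv)
      have "s w = (\<Sum>x\<in>A \<inter> N w. z x)"
        using fin by (simp add: s_def N_sym[of w])
      also have "N w = insert ys ((\<lambda>i. i # w) ` {..<Q})"
        using neighbours_word_tree_Cons jys by (auto simp: N_def)
      also have "A \<inter> \<dots> = (if k = Q then {ys} else insert ys ((\<lambda>i. i # w) ` {..<Q}))"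
      proof -
        have "ys \<in> A" using jys k by (auto simp: A_def words_def)
        moreover have "i # w \<in> A \<longleftrightarrow> k < Q" if "i < Q" for i
        proof -
          have "i # w \<in> A \<longleftrightarrow> (\<exists>l\<le>Q. Suc (Suc (2 * k)) = 2 * l)"
            using jys that by (simp add: A_def words_def Bex_def)
          also have "\<dots> \<longleftrightarrow> (\<exists>l\<le>Q. l = Suc k)" by presburger
          finally show ?thesis by auto
        qed
        ultimately show ?thesis using k by auto
      qed
      also have "(\<Sum>x\<in>\<dots>. z x) = (if k = Q then (- 1 / real Q) ^ Q else 0)"
      proof -
        have "ys \<notin> (\<lambda>i. i # w) ` {..<Q}" using jys by auto
        moreover have "(\<Sum>x\<in>(\<lambda>i. i # w) ` {..<Q}. z x) = Q * (- 1 / real Q) ^ Suc k"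
          using jys by (subst sum.reindex) (auto simp: inj_on_def z_def)
        ultimately show ?thesis using jys Q by (simp add: z_def)
      qed
      finally show ?thesis .
    qed
    have "(\<Sum>w\<in>W. (s w)\<^sup>2) = (\<Sum>k\<le>Q. \<Sum>w\<in>words Q (Suc (2 * k)). (s w)\<^sup>2)"
      unfolding W_def by (rule sum_words_UN) (simp add: inj_on_def)
    \<comment> \<open>The outermost sphere has (Q + 1) Q^(2Q) words, each with squared value
      Q^(-2Q).\<close>
    also have "\<dots> = (\<Sum>k\<le>Q. if k = Q then card (words Q (Suc (2 * Q))) * (1 / real Q ^ (2 * Q)) else 0)"
      by (intro sum.cong refl)
         (auto simp: s power_divide power2_eq_square mult_2 power_add simp flip: power_mult_distrib)
    also have "\<dots> = Q + 1"
      using Q by (simp add: card_words_Suc field_simps)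
    finally show ?thesis .
  qed
  also have "(\<Sum>x\<in>A. (z x)\<^sup>2) = Q + 2"
  proof -
    have "(\<Sum>x\<in>A. (z x)\<^sup>2) = (\<Sum>k\<le>Q. \<Sum>x\<in>words Q (2 * k). (z x)\<^sup>2)"
      unfolding A_def by (rule sum_words_UN) (simp add: inj_on_def)
    also have "\<dots> = (\<Sum>k\<le>Q. card (words Q (2 * k)) * (1 / real Q ^ (2 * k)))"
    proof (intro sum.cong refl)
      fix k
      have "(z x)\<^sup>2 = 1 / real Q ^ (2 * k)" if "x \<in> words Q (2 * k)" for x
        using that by (auto simp: z_def words_def power_divide power2_eq_square mult_2 power_add
            simp flip: power_mult_distrib)
      then show "(\<Sum>x\<in>words Q (2 * k). (z x)\<^sup>2) = card (words Q (2 * k)) * (1 / real Q ^ (2 * k))"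
        by simp
    qed
    \<comment> \<open>For k > 0 the sphere of radius 2k has (Q + 1) Q^(2k - 1) words of squared
      value Q^(-2k); the centre contributes 1.\<close>
    also have "\<dots> = (\<Sum>k\<le>Q. if k = 0 then 1 else (real Q + 1) / Q)"
    proof (intro sum.cong refl)
      fix k
      show "card (words Q (2 * k)) * (1 / real Q ^ (2 * k)) = (if k = 0 then 1 else (real Q + 1) / Q)"
        using Q by (cases k) (simp_all add: card_words_Suc field_simps)
    qed
    also have "\<dots> = Q + 2"
      using Q by (simp add: sum.atMost_shift)
    finally show ?thesis .
  qed
  \<comment> \<open>The quadratic form has come out as (Q + 1) - (Q + 2) = -1.\<close>
  finally show False by simp
qed

theorem corollary1p3:
  fixes q :: nat
    and S :: "'a pair_pre_digraph"
    and T :: "'b pair_pre_digraph"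
  assumes "2 \<le> q"
    and "is_T (q + 1) S"
    and "is_T q T"
  shows "R_plus S \<subset> R_plus T"
  using R_plus_is_T[OF assms(2)] R_plus_is_T[OF assms(3)]
    R_plus_word_tree_mono[of q "q + 1"] assms(1)
    common_neighbours_function_in_R_plus[of q] common_neighbours_function_notin_R_plus[of q]
  by auto

end
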